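(* Let $n\ge1$ be a fixed degree. Let $\widehat{s}_1,\ldots,\widehat{s}_n\in\mathbb{C}$ denote the poles of the $(n,n)$-Padé approximation to $\mathrm{e}^{z}$. Let $s_1(\omega),\ldots,s_n(\omega)\in\mathbb{C}$ denote the poles of the unitary best approximation $r_\omega\in\mathcal{U}_n$, $r_\omega(\mathrm{i} x)\approx \mathrm{e}^{\mathrm{i} \omega x}$. Then the poles can be numbered such that $$\omega\, s_j(\omega) \to \widehat{s}_j\quad\text{for }\omega \to 0^+,\quad j=1,\ldots,n.$$
   Context: For a complex polynomial $p$ let $p^\dag(z):=\overline{p}(-z)=\overline{p(-\overline z)}$, where $\overline p$ has complex-conjugated coefficients. Let $\mathcal{U}_n:=\{p^\dag/p : p \text{ a complex polynomial of degree}\le n,\ p\not\equiv 0\}$, with rational functions identified with their irreducible form; then $|r(\mathrm{i}x)|=1$ for $r\in\mathcal{U}_n$, $x\in\mathbb{R}$. For $r\in\mathcal{U}_n$, $\|r-\exp(\omega\cdot)\|:=\max_{x\in[-1,1]}|r(\mathrm{i}x)-\mathrm{e}^{\mathrm{i}\omega x}|$. For $\omega\in(0,(n+1)\pi)$ the unitary best approximation $r_\omega$ is the (existing and unique) element of $\mathcal{U}_n$ with $\|r_\omega-\exp(\omega\cdot)\|=\min_{u\in\mathcal{U}_n}\|u-\exp(\omega\cdot)\|$; it has exactly $n$ poles. The $(n,n)$-Padé approximation to $\mathrm{e}^z$ is the unique rational function $\widehat r=p/q$ with polynomials $p,q$ of degree $\le n$ and $q(0)=1$ such that $\widehat r(z)=\mathrm{e}^z+\mathcal{O}(|z|^{2n+1})$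 for $|z|\to0$; it has exactly $n$ poles. *)

theory Defs
  imports
    "HOL-Analysis.Analysis"
    "HOL-Computational_Algebra.Polynomial_Factorial"
    "HOL-Computational_Algebra.Field_as_Ring"
    "HOL-Library.Landau_Symbols"
    "HOL-Combinatorics.Permutations"
begin

text \<open>
  Rational functions are elements of the fraction field of the complex polynomials, so that
  common factors of numerator and denominator are immaterial; \<open>quot_of_fract\<close> yields the
  irreducible form (numerator, denominator), with monic denominator.
\<close>

type_synonym ratfun = "complex poly fract"

definition rat_eval :: "ratfun \<Rightarrow> complex \<Rightarrow> complex" where
  "rat_eval r z = poly (fst (quot_of_fract r)) z / poly (snd (quot_of_fract r)) z"

text \<open>The finite poles, with multiplicity.\<close>

definition rat_poles :: "ratfun \<Rightarrow> complex multiset" where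
  "rat_poles r = proots (snd (quot_of_fract r))"

text \<open>\<open>s 1, \<dots>, s n\<close> lists all poles of \<open>r\<close>, each repeated according to its multiplicity;
  in particular \<open>r\<close> has exactly \<open>n\<close> poles.\<close>

definition enumerates_poles :: "nat \<Rightarrow> (nat \<Rightarrow> complex) \<Rightarrow> ratfun \<Rightarrow> bool" where
  "enumerates_poles n s r \<longleftrightarrow> image_mset s (mset_set {1..n}) = rat_poles r"

definition dagger :: "complex poly \<Rightarrow> complex poly" where
  "dagger p = map_poly cnj p \<circ>\<^sub>p [:0, -1:]"

lemma poly_dagger: "poly (dagger p) z = cnj (poly p (- cnj z))"
  by (simp add: dagger_def poly_pcompose)

definition unitary_ratfuns :: "nat \<Rightarrow> ratfun set" where
  "unitary_ratfuns n = {Fract (dagger p) p | p. degree p \<le> n \<and> p \<noteq> 0}"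

text \<open>For unitary \<open>r\<close> the supremum below is a maximum: the irreducible form has no pole on
  the imaginary axis, since \<open>\<bar>r(ix)\<bar> = 1\<close> wherever \<open>r(ix)\<close> is defined.\<close>

definition approx_error :: "real \<Rightarrow> ratfun \<Rightarrow> real" where
  "approx_error \<omega> r =
     (SUP x\<in>{-1..1::real}. norm (rat_eval r (\<i> * of_real x) - exp (\<i> * of_real (\<omega> * x))))"

definition is_unitary_best_approx :: "nat \<Rightarrow> real \<Rightarrow> ratfun \<Rightarrow> bool" where
  "is_unitary_best_approx n \<omega> r \<longleftrightarrow>
     r \<in> unitary_ratfuns n \<and> (\<forall>u\<in>unitary_ratfuns n. approx_error \<omega> r \<le> approx_error \<omega> u)"

definition is_pade_exp :: "nat \<Rightarrow> ratfun \<Rightarrow> bool" where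
  "is_pade_exp n r \<longleftrightarrow>
     (\<exists>p q. degree p \<le> n \<and> degree q \<le> n \<and> poly q 0 = 1 \<and> r = Fract p q) \<and>
     (\<lambda>z. rat_eval r z - exp z) \<in> O[at 0](\<lambda>z. z ^ (2 * n + 1))"

end

theory Submission
  imports Defs "HOL-Computational_Algebra.Fundamental_Theorem_Algebra"
begin

text \<open>
  The best approximation is at least as accurate as a rescaled Pade approximation, and this accuracy
  alone determines the denominator up to \<open>O(\<omega>)\<close>. Write \<open>rhat = a / b\<close> for the Pade approximation in irreducible
  form, with monic \<open>b\<close>.

  The Pade approximation is itself unitary: \<open>\<bar>a\<bar>\<^sup>2 - \<bar>b\<bar>\<^sup>2\<close> on the imaginary axis is a polynomial of
  degree at most \<open>2n\<close> that is \<open>O(x^(2n+1))\<close> at \<open>0\<close>, so it vanishes, and the rest follows from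
  coprimality (\<open>is_pade_exp_unitary\<close>). Hence \<open>z \<mapsto> rhat (\<omega> z)\<close> competes with \<open>r \<omega>\<close>, and the
  best approximation has error \<open>O(\<omega>^(2n+1))\<close> (\<open>best_approx_error_bound\<close>).

  Rescale: \<open>P / Q = r \<omega> (z / \<omega>)\<close> with \<open>Q\<close> monic of degree \<open>n\<close>, whose roots are the numbers
  \<open>\<omega> s \<omega> j\<close>. Both \<open>P / Q\<close> and \<open>a / b\<close> differ from \<open>exp\<close> by \<open>O(\<omega>^(2n+1))\<close> on the segment
  \<open>\<i> [-\<omega>, \<omega>]\<close>, so the polynomial \<open>D = a Q - P b\<close> is \<open>O(\<omega>^(2n+1))\<close> there, relative to the size
  of \<open>Q\<close>. Since \<open>D\<close> has degree at most \<open>2n\<close>, interpolation shows that each coefficient of \<open>D\<close> is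
  \<open>O(\<omega>)\<close> (\<open>coeff_norm_bound_of_small_on_imaginary_segment\<close>). If \<open>u a + v b = 1\<close>, then
  \<open>Q\<close> is congruent to \<open>u D\<close> modulo \<open>b\<close>; as \<open>Q\<close> and \<open>b\<close> are both monic of degree \<open>n\<close>, this says that
  \<open>Q - b\<close> is the remainder of \<open>u D\<close>, hence \<open>O(\<omega>)\<close> (\<open>monic_denominators_close\<close>).

  So \<open>Q\<close> tends to \<open>b\<close> coefficientwise, and its roots tend to the roots of \<open>b\<close> in a suitable
  numbering (\<open>roots_tendsto_up_to_numbering\<close>).
\<close>

section \<open>Coefficient estimates\<close>

definition coeff_norm :: "complex poly \<Rightarrow> real" where
  "coeff_norm p = (\<Sum>k\<le>degree p. norm (coeff p k))"

lemma coeff_norm_eq: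
  assumes "degree p \<le> N"
  shows "coeff_norm p = (\<Sum>k\<le>N. norm (coeff p k))"
  unfolding coeff_norm_def
  by (rule sum.mono_neutral_left) (use assms in \<open>auto simp: coeff_eq_0\<close>)

lemma coeff_norm_nonneg [simp]: "0 \<le> coeff_norm p"
  by (simp add: coeff_norm_def sum_nonneg)

lemma coeff_norm_0 [simp]: "coeff_norm 0 = 0"
  by (simp add: coeff_norm_def)

lemma norm_coeff_le_coeff_norm: "norm (coeff p k) \<le> coeff_norm p"
proof (cases "k \<le> degree p")
  case True
  then show ?thesis
    unfolding coeff_norm_def by (intro member_le_sum) auto
qed (simp add: coeff_eq_0)

lemma norm_poly_le_coeff_norm:
  assumes "norm z \<le> 1"
  shows "norm (poly p z) \<le> coeff_norm p"
proof -
  have "norm (poly p z) \<le> (\<Sum>k\<le>degree p. norm (coeff p k * z ^ k))"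
    unfolding poly_altdef by (rule norm_sum)
  also have "\<dots> \<le> coeff_norm p"
    unfolding coeff_norm_def using assms
    by (intro sum_mono) (auto simp: norm_mult norm_power intro!: mult_left_le power_le_one)
  finally show ?thesis .
qed

lemma coeff_norm_add: "coeff_norm (p + q) \<le> coeff_norm p + coeff_norm q"
proof -
  let ?N = "max (degree p) (degree q)"
  have "coeff_norm (p + q) = (\<Sum>k\<le>?N. norm (coeff p k + coeff q k))"
    by (subst coeff_norm_eq[OF degree_add_le_max]) simp
  also have "\<dots> \<le> (\<Sum>k\<le>?N. norm (coeff p k)) + (\<Sum>k\<le>?N. norm (coeff q k))"
    unfolding sum.distrib[symmetric] by (intro sum_mono norm_triangle_ineq)
  finally show ?thesis
    by (simp add: coeff_norm_eq[of p ?N] coeff_norm_eq[of q ?N])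
qed

lemma coeff_norm_sum: "coeff_norm (sum f A) \<le> (\<Sum>x\<in>A. coeff_norm (f x))"
  by (induction A rule: infinite_finite_induct)
     (auto intro: order_trans[OF coeff_norm_add])

lemma coeff_norm_smult: "coeff_norm (smult c p) = norm c * coeff_norm p"
  by (subst coeff_norm_eq[OF degree_smult_le])
     (simp add: coeff_norm_def norm_mult sum_distrib_left)

text \<open>
  The products are the Lagrange basis polynomials of the nodes: each is \<open>1\<close> at its own node and
  \<open>0\<close> at the others, so the two sides agree at \<open>N + 1\<close> points.
\<close>

lemma lagrange_interpolation_formula:
  fixes \<xi> :: "nat \<Rightarrow> 'a :: field"
  assumes inj: "inj_on \<xi> {..N}" and "degree p \<le> N"
  shows "p = (\<Sum>j\<le>N. smult (poly p (\<xi> j))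
                 (\<Prod>i\<in>{..N} - {j}. smult (1 / (\<xi> j - \<xi> i)) [:- \<xi> i, 1:]))"
    (is "p = (\<Sum>j\<le>N. smult _ (?L j))")
proof (rule poly_eqI_degree)
  have L: "poly (?L j) (\<xi> i) = (if i = j then 1 else 0)" if "i \<le> N" "j \<le> N" for i j
  proof (cases "i = j")
    case True
    have "\<xi> j - \<xi> k \<noteq> 0" if "k \<in> {..N} - {j}" for k
      using inj that \<open>j \<le> N\<close> by (auto simp: inj_on_def)
    then show ?thesis
      using True by (simp add: poly_prod divide_simps)
  next
    case False
    then show ?thesis
      using that by (auto simp: poly_prod intro!: prod_zero)
  qed
  show "poly p x = poly (\<Sum>j\<le>N. smult (poly p (\<xi> j)) (?L j)) x" if x: "x \<in> \<xi> ` {..N}" for x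
  proof -
    obtain i where i: "i \<le> N" "x = \<xi> i"
      using x by blast
    have "poly (\<Sum>j\<le>N. smult (poly p (\<xi> j)) (?L j)) x
        = (\<Sum>j\<le>N. poly p (\<xi> j) * poly (?L j) (\<xi> i))"
      by (simp only: poly_sum poly_smult i(2))
    also have "\<dots> = (\<Sum>j\<le>N. if i = j then poly p (\<xi> j) else 0)"
    proof (intro sum.cong refl)
      fix j
      assume "j \<in> {..N}"
      then have "poly (?L j) (\<xi> i) = (if i = j then 1 else 0)"
        using i(1) by (intro L) auto
      then show "poly p (\<xi> j) * poly (?L j) (\<xi> i) = (if i = j then poly p (\<xi> j) else 0)"
        by (simp only: mult_1_right mult_zero_right split: if_split) simp
    qed
    finally show ?thesis
      using i by simp
  qed
  have "degree (?L j) \<le> N" if "j \<le> N" for j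
  proof -
    have "degree (?L j) \<le> (\<Sum>i\<in>{..N} - {j}. degree (smult (1 / (\<xi> j - \<xi> i)) [:- \<xi> i, 1:]))"
      by (rule order_trans[OF degree_prod_sum_le]) (simp_all only: o_def finite_Diff finite_atMost)
    also have "\<dots> \<le> (\<Sum>i\<in>{..N} - {j}. 1)"
      by (intro sum_mono order_trans[OF degree_smult_le]) simp
    also have "\<dots> = N"
      using that by simp
    finally show ?thesis .
  qed
  then have "degree (\<Sum>j\<le>N. smult (poly p (\<xi> j)) (?L j)) \<le> N"
    by (intro degree_sum_le) (auto intro: order_trans[OF degree_smult_le])
  then show "degree (\<Sum>j\<le>N. smult (poly p (\<xi> j)) (?L j)) < card (\<xi> ` {..N})"
    by (simp add: card_image[OF inj])
  show "degree p < card (\<xi> ` {..N})"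
    using assms by (simp add: card_image)
qed

text \<open>
  On a fixed segment, interpolation expresses the coefficients of \<open>p\<close> linearly in its
  values at fixed nodes. Rescaling the variable from half-length \<open>h\<close> to half-length \<open>1\<close> multiplies the
  \<open>k\<close>-th coefficient by \<open>h ^ k\<close>, so that one constant serves all \<open>h\<close>.
\<close>

lemma coeff_bound_of_bound_on_imaginary_segment:
  obtains K where "0 \<le> K"
    "\<And>p B h k. degree p \<le> N \<Longrightarrow> 0 < h \<Longrightarrow>
      (\<And>x. \<bar>x\<bar> \<le> h \<Longrightarrow> norm (poly p (\<i> * of_real x)) \<le> B) \<Longrightarrow> norm (coeff p k) * h ^ k \<le> K * B"
proof -
  \<comment> \<open>The denominator \<open>N + 1\<close> instead of \<open>N\<close> keeps the nodes meaningful for \<open>N = 0\<close>.\<close>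
  define \<xi> :: "nat \<Rightarrow> complex" where "\<xi> j = of_real (real j / real (N + 1))" for j
  define L where "L j = (\<Prod>i\<in>{..N} - {j}. smult (1 / (\<xi> j - \<xi> i)) [:- \<xi> i, 1:])" for j
  have inj: "inj_on \<xi> {..N}"
    by (auto simp: inj_on_def \<xi>_def simp del: of_real_divide of_nat_add)
  have "norm (coeff p k) * h ^ k \<le> (\<Sum>j\<le>N. coeff_norm (L j)) * B"
    if deg: "degree p \<le> N" and h: "0 < h"
      and B: "\<And>x. \<bar>x\<bar> \<le> h \<Longrightarrow> norm (poly p (\<i> * of_real x)) \<le> B" for p B h k
  proof -
    define H where "H = pcompose p [:0, \<i> * of_real h:]"
    have "degree H \<le> N"
      using degree_pcompose_le[of p "[:0, \<i> * of_real h:]"] deg by (auto simp: H_def split: if_splits)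
    then have "H = (\<Sum>j\<le>N. smult (poly H (\<xi> j)) (L j))"
      unfolding L_def using inj by (rule lagrange_interpolation_formula[rotated])
    then have *: "coeff H k = (\<Sum>j\<le>N. poly H (\<xi> j) * coeff (L j) k)"
      by (metis (mono_tags, lifting) coeff_smult coeff_sum sum.cong)
    have val: "norm (poly H (\<xi> j)) \<le> B" if "j \<le> N" for j
    proof -
      have "poly H (\<xi> j) = poly p (\<i> * of_real (h * (real j / real (N + 1))))"
        by (simp add: H_def poly_pcompose \<xi>_def mult_ac)
      moreover have "h * (real j / real (N + 1)) \<le> h"
        using h that by (intro mult_left_le) auto
      ultimately show ?thesis
        using h by (simp only:) (rule B, simp)
    qed
    have "norm (coeff p k) * h ^ k = norm (coeff H k)"
      using h by (simp add: H_def coeff_pcompose_linear norm_mult norm_power)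
    also have "\<dots> \<le> (\<Sum>j\<le>N. norm (poly H (\<xi> j) * coeff (L j) k))"
      unfolding * by (rule norm_sum)
    also have "\<dots> \<le> (\<Sum>j\<le>N. B * coeff_norm (L j))"
      unfolding norm_mult using val B[of 0] h
      by (intro sum_mono mult_mono norm_coeff_le_coeff_norm)
         (auto intro: order_trans[OF norm_ge_zero])
    finally show ?thesis
      by (simp add: sum_distrib_left mult.commute)
  qed
  moreover have "0 \<le> (\<Sum>j\<le>N. coeff_norm (L j))"
    by (intro sum_nonneg) simp
  ultimately show thesis
    by (rule that[rotated])
qed

text \<open>
  A polynomial of degree at most \<open>N\<close> cannot be of order \<open>h ^ (N + 1)\<close> on a segment of half-length
  \<open>h\<close> unless its coefficients are of order \<open>h\<close>: the division by \<open>h ^ k\<close> with \<open>k \<le> N\<close> costs at most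
  \<open>N\<close> of the \<open>N + 1\<close> powers.
\<close>

lemma coeff_norm_bound_of_small_on_imaginary_segment:
  obtains K where "0 \<le> K"
    "\<And>p B h. degree p \<le> N \<Longrightarrow> 0 < h \<Longrightarrow> h \<le> 1 \<Longrightarrow>
      (\<And>x. \<bar>x\<bar> \<le> h \<Longrightarrow> norm (poly p (\<i> * of_real x)) \<le> B * h ^ (N + 1)) \<Longrightarrow>
      coeff_norm p \<le> K * B * h"
proof -
  obtain K where K0: "0 \<le> K"
    and K: "\<And>p B h k. degree p \<le> N \<Longrightarrow> 0 < h \<Longrightarrow>
      (\<And>x. \<bar>x\<bar> \<le> h \<Longrightarrow> norm (poly p (\<i> * of_real x)) \<le> B) \<Longrightarrow> norm (coeff p k) * h ^ k \<le> K * B"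
    using coeff_bound_of_bound_on_imaginary_segment[of N] by blast
  have "coeff_norm p \<le> (real N + 1) * K * B * h"
    if deg: "degree p \<le> N" and h: "0 < h" "h \<le> 1"
      and B: "\<And>x. \<bar>x\<bar> \<le> h \<Longrightarrow> norm (poly p (\<i> * of_real x)) \<le> B * h ^ (N + 1)" for p B h
  proof -
    have "norm (poly p (\<i> * of_real 0)) \<le> B * h ^ (N + 1)"
      using h by (intro B) simp
    then have "0 \<le> B * h ^ (N + 1)"
      using norm_ge_zero order_trans by blast
    moreover have "0 < h ^ (N + 1)"
      using h by simp
    ultimately have B0: "0 \<le> B"
      by (meson not_le mult_neg_pos)
    have "norm (coeff p k) \<le> K * B * h" if "k \<le> N" for k
    proof -
      have "norm (coeff p k) * h ^ k \<le> K * (B * h ^ (N + 1))"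
        by (rule K[OF deg h(1) B])
      also have "\<dots> = (K * B * h ^ (N - k) * h) * h ^ k"
      proof -
        have "h ^ (N + 1) = h ^ (N - k) * h ^ k * h"
          using that by (simp add: power_add[symmetric])
        then show ?thesis
          by (simp only: mult_ac)
      qed
      finally have "norm (coeff p k) \<le> K * B * h ^ (N - k) * h"
        by (rule mult_right_le_imp_le) (use h in simp)
      also have "\<dots> \<le> K * B * 1 * h"
        using h K0 B0 by (intro mult_right_mono mult_left_mono power_le_one) auto
      finally show ?thesis
        by simp
    qed
    then have "(\<Sum>k\<le>N. norm (coeff p k)) \<le> (\<Sum>k\<le>N. K * B * h)"
      by (intro sum_mono) simp
    then show ?thesis
      by (simp add: coeff_norm_eq[OF deg] algebra_simps)
  qed
  moreover have "0 \<le> (real N + 1) * K"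
    using K0 by simp
  ultimately show thesis
    by (rule that[rotated])
qed

text \<open>
  Multiplication by \<open>u\<close> followed by reduction modulo \<open>m\<close> is linear, and on the finite-dimensional
  space of polynomials of bounded degree it is therefore bounded.
\<close>

lemma coeff_norm_mult_mod_bound:
  obtains K where "0 \<le> K"
    "\<And>d. degree d \<le> N \<Longrightarrow> coeff_norm (u * d mod m) \<le> K * coeff_norm d"
proof
  let ?K = "\<Sum>k\<le>N. coeff_norm (u * monom 1 k mod m)"
  show "0 \<le> ?K"
    by (intro sum_nonneg) simp
  fix d :: "complex poly"
  assume deg: "degree d \<le> N"
  have mod_sum: "(\<Sum>k\<in>A. f k) mod m = (\<Sum>k\<in>A. f k mod m)" if "finite A"
    for f :: "nat \<Rightarrow> complex poly" and A
    using that by (induction A) (auto simp: poly_mod_add_left)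
  have "u * d = (\<Sum>k\<le>N. smult (coeff d k) (u * monom 1 k))"
    by (subst poly_as_sum_of_monoms'[OF deg, symmetric])
       (simp add: sum_distrib_left smult_monom flip: mult_smult_right)
  then have "u * d mod m = (\<Sum>k\<le>N. smult (coeff d k) (u * monom 1 k mod m))"
    by (simp add: mod_sum mod_smult_left)
  then have "coeff_norm (u * d mod m)
      \<le> (\<Sum>k\<le>N. norm (coeff d k) * coeff_norm (u * monom 1 k mod m))"
    using coeff_norm_sum[of "\<lambda>k. smult (coeff d k) (u * monom 1 k mod m)" "{..N}"]
    by (simp add: coeff_norm_smult)
  also have "\<dots> \<le> (\<Sum>k\<le>N. coeff_norm d * coeff_norm (u * monom 1 k mod m))"
    by (intro sum_mono mult_right_mono norm_coeff_le_coeff_norm) simp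
  finally show "coeff_norm (u * d mod m) \<le> ?K * coeff_norm d"
    by (simp add: sum_distrib_left mult.commute)
qed

section \<open>Roots depend continuously on the coefficients\<close>

text \<open>
  Synthetic division computes the coefficients of the quotient from the top down, each by
  continuous operations from \<open>t\<close>, the product, and the coefficient above it.
\<close>

lemma tendsto_coeff_divide_linear_factor:
  fixes q :: "'a \<Rightarrow> complex poly" and q' :: "complex poly"
  assumes deg: "\<And>\<omega>. degree (q \<omega>) \<le> m" "degree q' \<le> m"
    and t: "(t \<longlongrightarrow> a) F"
    and lim: "\<And>k. ((\<lambda>\<omega>. coeff ([:- t \<omega>, 1:] * q \<omega>) k) \<longlongrightarrow> coeff ([:- a, 1:] * q') k) F"
  shows "((\<lambda>\<omega>. coeff (q \<omega>) k) \<longlongrightarrow> coeff q' k) F"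
proof -
  have rec: "coeff p j = coeff ([:- c, 1:] * p) (Suc j) + c * coeff p (Suc j)"
    for c :: complex and p j
    by simp
  have "((\<lambda>\<omega>. coeff (q \<omega>) k) \<longlongrightarrow> coeff q' k) F" if "k \<le> Suc m" for k
    using that
  proof (induction k rule: inc_induct)
    case base
    then show ?case
      using deg by (simp add: coeff_eq_0 le_imp_less_Suc)
  next
    case (step k)
    have "(\<lambda>\<omega>. coeff (q \<omega>) k)
        = (\<lambda>\<omega>. coeff ([:- t \<omega>, 1:] * q \<omega>) (Suc k) + t \<omega> * coeff (q \<omega>) (Suc k))"
      by (rule ext) (rule rec)
    then show ?case
      unfolding rec[of q' k a] 
      by (simp only:) (intro tendsto_add tendsto_mult lim step.IH t)
  qed
  moreover have "((\<lambda>\<omega>. coeff (q \<omega>) k) \<longlongrightarrow> coeff q' k) F" if "k > Suc m" for k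
    using that deg by (simp add: coeff_eq_0 le_less_trans[of _ m])
  ultimately show ?thesis
    by (meson not_le)
qed

text \<open>
  The product of the distances from a limit root \<open>a\<close> to the roots \<open>t \<omega> j\<close> is the modulus of the
  polynomial at \<open>a\<close>, which tends to \<open>0\<close>; so the nearest root tends to \<open>a\<close>. It is given the last
  number and divided out, and the quotients again converge coefficientwise.
\<close>

lemma roots_tendsto_up_to_numbering:
  fixes t :: "'a \<Rightarrow> nat \<Rightarrow> complex" and a :: "nat \<Rightarrow> complex"
  assumes "\<And>k. ((\<lambda>\<omega>. coeff (\<Prod>j\<in>{1..n}. [:- t \<omega> j, 1:]) k)
                  \<longlongrightarrow> coeff (\<Prod>j\<in>{1..n}. [:- a j, 1:]) k) F"
  shows "\<exists>\<sigma>. (\<forall>\<omega>. \<sigma> \<omega> permutes {1..n}) \<and> (\<forall>j\<in>{1..n}. ((\<lambda>\<omega>. t \<omega> (\<sigma> \<omega> j)) \<longlongrightarrow> a j) F)"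
  using assms
proof (induction n arbitrary: t)
  case 0
  show ?case
    by (intro exI[of _ "\<lambda>_. id"]) (auto simp: permutes_id)
next
  case (Suc n)
  let ?N = "Suc n"
  have dist_poly: "norm (poly (\<Prod>j\<in>{1..?N}. [:- t \<omega> j, 1:]) z) = (\<Prod>j\<in>{1..?N}. norm (z - t \<omega> j))"
    for \<omega> z
    by (simp add: poly_prod del: prod.cl_ivl_Suc flip: prod_norm)
  have "\<exists>i. i \<in> {1..?N} \<and> (\<forall>j\<in>{1..?N}. norm (a ?N - t \<omega> i) \<le> norm (a ?N - t \<omega> j))" for \<omega>
    using ex_min_if_finite[of "(\<lambda>j. norm (a ?N - t \<omega> j)) ` {1..?N}"]
    by (auto simp: not_less)
  then obtain i where i: "\<And>\<omega>. i \<omega> \<in> {1..?N}"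
    and min: "\<And>\<omega> j. j \<in> {1..?N} \<Longrightarrow> norm (a ?N - t \<omega> (i \<omega>)) \<le> norm (a ?N - t \<omega> j)"
    by metis
  have val: "((\<lambda>\<omega>. poly (\<Prod>j\<in>{1..?N}. [:- t \<omega> j, 1:]) z)
               \<longlongrightarrow> poly (\<Prod>j\<in>{1..?N}. [:- a j, 1:]) z) F" for z
  proof -
    have deg: "degree (\<Prod>j\<in>{1..?N}. [:- f j, 1:]) = ?N" for f :: "nat \<Rightarrow> complex"
      by (simp add: degree_prod_sum_eq del: prod.cl_ivl_Suc)
    show ?thesis
      unfolding poly_altdef deg by (intro tendsto_intros Suc.prems)
  qed
  have lim_i: "((\<lambda>\<omega>. t \<omega> (i \<omega>)) \<longlongrightarrow> a ?N) F"
  proof -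
    have lim_norm: "((\<lambda>\<omega>. norm (poly (\<Prod>j\<in>{1..?N}. [:- t \<omega> j, 1:]) (a ?N))) \<longlongrightarrow> 0) F"
      using tendsto_norm[OF val[of "a ?N"]] by (simp add: poly_prod)
    have "norm (norm (a ?N - t \<omega> (i \<omega>)) ^ ?N)
        \<le> norm (poly (\<Prod>j\<in>{1..?N}. [:- t \<omega> j, 1:]) (a ?N))" for \<omega>
      unfolding dist_poly
      using prod_mono[of "{1..?N}" "\<lambda>_. norm (a ?N - t \<omega> (i \<omega>))" "\<lambda>j. norm (a ?N - t \<omega> j)"] min
      by (simp add: norm_power del: prod.cl_ivl_Suc power_Suc)
    then have "((\<lambda>\<omega>. norm (a ?N - t \<omega> (i \<omega>)) ^ ?N) \<longlongrightarrow> 0) F"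
      by (intro Lim_null_comparison[OF always_eventually lim_norm] allI)
    then have "((\<lambda>\<omega>. root ?N (norm (a ?N - t \<omega> (i \<omega>)) ^ ?N)) \<longlongrightarrow> root ?N 0) F"
      by (rule tendsto_real_root)
    then have "((\<lambda>\<omega>. norm (t \<omega> (i \<omega>) - a ?N)) \<longlongrightarrow> 0) F"
      by (simp add: real_root_power_cancel norm_minus_commute del: power_Suc)
    then show ?thesis
      by (simp add: tendsto_norm_zero_iff LIM_zero_iff)
  qed
  define \<tau> where "\<tau> \<omega> = Transposition.transpose (i \<omega>) ?N" for \<omega>
  have \<tau>: "\<tau> \<omega> permutes {1..?N}" for \<omega>
    unfolding \<tau>_def using i by (intro permutes_swap_id) auto
  define t' where "t' \<omega> j = t \<omega> (\<tau> \<omega> j)" for \<omega> j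
  have last: "t' \<omega> ?N = t \<omega> (i \<omega>)" for \<omega>
    by (simp add: t'_def \<tau>_def)
  have split: "(\<Prod>j\<in>{1..?N}. [:- t \<omega> j, 1:]) = [:- t \<omega> (i \<omega>), 1:] * (\<Prod>j\<in>{1..n}. [:- t' \<omega> j, 1:])"
    for \<omega>
  proof -
    have "(\<Prod>j\<in>{1..?N}. [:- t \<omega> j, 1:]) = (\<Prod>j\<in>{1..?N}. [:- t' \<omega> j, 1:])"
      unfolding t'_def using prod.permute[OF \<tau>[of \<omega>], of "\<lambda>j. [:- t \<omega> j, 1:]"] by (simp add: o_def)
    then show ?thesis
      by (simp add: last del: mult_pCons_left mult_pCons_right)
  qed
  have deg: "degree (\<Prod>j\<in>{1..n}. [:- f j, 1:]) = n" for f :: "nat \<Rightarrow> complex"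
    by (simp add: degree_prod_sum_eq)
  have "((\<lambda>\<omega>. coeff (\<Prod>j\<in>{1..n}. [:- t' \<omega> j, 1:]) k)
          \<longlongrightarrow> coeff (\<Prod>j\<in>{1..n}. [:- a j, 1:]) k) F" for k
  proof (rule tendsto_coeff_divide_linear_factor[where m = n, OF _ _ lim_i])
    show "((\<lambda>\<omega>. coeff ([:- t \<omega> (i \<omega>), 1:] * (\<Prod>j\<in>{1..n}. [:- t' \<omega> j, 1:])) k)
        \<longlongrightarrow> coeff ([:- a ?N, 1:] * (\<Prod>j\<in>{1..n}. [:- a j, 1:])) k) F" for k
      using Suc.prems[of k] unfolding split
      by (simp add: mult.commute del: mult_pCons_left mult_pCons_right)
  qed (simp_all only: deg order_refl)
  from Suc.IH[OF this] obtain \<sigma> where \<sigma>: "\<And>\<omega>. \<sigma> \<omega> permutes {1..n}"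
    and lim: "\<And>j. j \<in> {1..n} \<Longrightarrow> ((\<lambda>\<omega>. t' \<omega> (\<sigma> \<omega> j)) \<longlongrightarrow> a j) F"
    by blast
  have fix_last: "\<sigma> \<omega> ?N = ?N" for \<omega>
    using permutes_not_in[OF \<sigma>] by simp
  show ?case
  proof (intro exI[of _ "\<lambda>\<omega>. \<tau> \<omega> \<circ> \<sigma> \<omega>"] conjI allI ballI)
    show "\<tau> \<omega> \<circ> \<sigma> \<omega> permutes {1..?N}" for \<omega>
      by (intro permutes_compose \<tau> permutes_subset[OF \<sigma>]) auto
    fix j
    assume "j \<in> {1..?N}"
    then consider "j \<in> {1..n}" | "j = ?N"
      by fastforce
    then show "((\<lambda>\<omega>. t \<omega> ((\<tau> \<omega> \<circ> \<sigma> \<omega>) j)) \<longlongrightarrow> a j) F"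
    proof cases
      case 1
      then show ?thesis
        using lim by (simp add: t'_def)
    next
      case 2
      then show ?thesis
        using lim_i last by (simp add: fix_last t'_def)
    qed
  qed
qed

section \<open>Unitary rational functions\<close>

lemma quot_of_fract_Fract_cancel:
  fixes p q :: "complex poly"
  assumes "q \<noteq> 0"
  obtains g where "g \<noteq> 0" "p = fst (quot_of_fract (Fract p q)) * g"
    "q = snd (quot_of_fract (Fract p q)) * g"
proof -
  define a b where "a = fst (quot_of_fract (Fract p q))" and "b = snd (quot_of_fract (Fract p q))"
  have b: "b \<noteq> 0"
    by (simp add: b_def)
  have "Fract a b = Fract p q"
    by (simp add: a_def b_def)
  then have eq: "a * q = p * b"
    using assms b by (simp add: eq_fract)
  have "coprime b a"
    unfolding a_def b_def using coprime_quot_of_fract coprime_commute by blast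
  moreover have "b dvd a * q"
    by (simp add: eq)
  ultimately have "b dvd q"
    by (simp add: coprime_dvd_mult_right_iff)
  then obtain g where q: "q = b * g" ..
  have p: "p = a * g"
    using eq b by (simp add: q)
  have "g \<noteq> 0"
    using assms q by auto
  then show thesis
    using p q unfolding a_def b_def by (rule that)
qed

lemma rat_eval_Fract:
  assumes "poly q z \<noteq> 0"
  shows "rat_eval (Fract p q) z = poly p z / poly q z"
proof -
  have "q \<noteq> 0"
    using assms by auto
  then obtain g where "p = fst (quot_of_fract (Fract p q)) * g" "q = snd (quot_of_fract (Fract p q)) * g"
    by (rule quot_of_fract_Fract_cancel)
  then have "poly p z = poly (fst (quot_of_fract (Fract p q))) z * poly g z"
    "poly q z = poly (snd (quot_of_fract (Fract p q))) z * poly g z"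
    by (metis poly_mult)+
  with assms show ?thesis
    by (simp add: rat_eval_def)
qed

lemma dagger_mult: "dagger (p * q) = dagger p * dagger q"
  by (simp flip: poly_eq_poly_eq_iff add: fun_eq_iff poly_dagger)

lemma dagger_dagger [simp]: "dagger (dagger p) = p"
  by (simp flip: poly_eq_poly_eq_iff add: fun_eq_iff poly_dagger)

lemma dagger_pcompose_of_real:
  "dagger (pcompose p [:0, of_real h:]) = pcompose (dagger p) [:0, of_real h:]"
  by (simp flip: poly_eq_poly_eq_iff add: fun_eq_iff poly_dagger poly_pcompose)

lemma degree_dagger [simp]: "degree (dagger p) = degree p"
  by (simp add: dagger_def degree_pcompose degree_map_poly)

lemma dagger_0_iff [simp]: "dagger p = 0 \<longleftrightarrow> p = 0"
  by (metis dagger_dagger dagger_def map_poly_0 pcompose_0)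

lemma poly_dagger_imaginary: "poly (dagger p) (\<i> * of_real x) = cnj (poly p (\<i> * of_real x))"
  by (simp add: poly_dagger)

text \<open>
  Cancelling a common factor need not leave a quotient of the form \<open>dagger p / p\<close> on the nose, but
  the identity \<open>a * dagger a = b * dagger b\<close> survives, and it says that \<open>a\<close> and \<open>b\<close> have equal
  modulus on the imaginary axis. A zero of \<open>b\<close> there would thus be a zero of \<open>a\<close>, against coprimality.
\<close>

lemma unitary_ratfun_reduced:
  assumes "u \<in> unitary_ratfuns n"
  defines "a \<equiv> fst (quot_of_fract u)" and "b \<equiv> snd (quot_of_fract u)"
  shows "degree a \<le> n"
    and "norm (poly a (\<i> * of_real x)) = norm (poly b (\<i> * of_real x))"
    and "poly b (\<i> * of_real x) \<noteq> 0"
proof -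
  obtain p where p: "u = Fract (dagger p) p" "degree p \<le> n" "p \<noteq> 0"
    using assms(1) by (auto simp: unitary_ratfuns_def)
  obtain g where g: "g \<noteq> 0" "dagger p = a * g" "p = b * g"
    using quot_of_fract_Fract_cancel[OF \<open>p \<noteq> 0\<close>, of "dagger p"] unfolding a_def b_def p(1) by metis
  have a0: "a \<noteq> 0"
    using g(2) p(3) by (metis dagger_0_iff mult_zero_left)
  have "degree (dagger p) = degree a + degree g"
    unfolding g(2) using a0 g(1) by (rule degree_mult_eq)
  then show "degree a \<le> n"
    using p(2) by simp
  have "a * g = dagger p"
    by (simp only: g(2))
  also have "\<dots> = dagger b * dagger g"
    by (simp only: g(3) dagger_mult)
  finally have ag: "a * g = dagger b * dagger g" .
  have "b * g = dagger (dagger p)"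
    by (simp add: g(3))
  also have "\<dots> = dagger a * dagger g"
    by (simp only: g(2) dagger_mult)
  finally have bg: "b * g = dagger a * dagger g" .
  have "(a * g) * (dagger a * dagger g) = (b * g) * (dagger b * dagger g)"
    by (simp only: ag bg mult.commute)
  then have "(a * dagger a) * (g * dagger g) = (b * dagger b) * (g * dagger g)"
    by (simp only: mult_ac)
  then have "a * dagger a = b * dagger b"
    using g(1) by simp
  then have "poly (a * dagger a) (\<i> * of_real x) = poly (b * dagger b) (\<i> * of_real x)"
    by simp
  then have "(norm (poly a (\<i> * of_real x)))\<^sup>2 = (norm (poly b (\<i> * of_real x)))\<^sup>2"
    by (simp only: poly_mult poly_dagger_imaginary complex_norm_square[symmetric] of_real_eq_iff)
  then show eq: "norm (poly a (\<i> * of_real x)) = norm (poly b (\<i> * of_real x))"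
    by simp
  show "poly b (\<i> * of_real x) \<noteq> 0"
  proof
    assume "poly b (\<i> * of_real x) = 0"
    moreover from this have "poly a (\<i> * of_real x) = 0"
      using eq by simp
    moreover have "coprime a b"
      unfolding a_def b_def by (rule coprime_quot_of_fract)
    ultimately show False
      using coprime_poly_0 by blast
  qed
qed

text \<open>
  The real supremum in the definition of the error dominates each value because the set is
  bounded: both functions have modulus \<open>1\<close> on the imaginary axis.
\<close>

lemma norm_diff_exp_le_approx_error:
  assumes "u \<in> unitary_ratfuns n" "\<bar>x\<bar> \<le> 1"
  shows "norm (rat_eval u (\<i> * of_real x) - exp (\<i> * of_real (\<omega> * x))) \<le> approx_error \<omega> u"
  unfolding approx_error_def
proof (rule cSUP_upper)
  show "x \<in> {-1..1}"
    using assms(2) by auto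
  have "norm (rat_eval u (\<i> * of_real y)) = 1" for y
    using unitary_ratfun_reduced(2,3)[OF assms(1), of y] by (simp add: rat_eval_def norm_divide)
  then have "norm (rat_eval u (\<i> * of_real y) - exp (\<i> * of_real (\<omega> * y))) \<le> 1 + 1" for y
    by (metis norm_triangle_ineq4 norm_exp_i_times)
  then show "bdd_above ((\<lambda>x. norm (rat_eval u (\<i> * of_real x) - exp (\<i> * of_real (\<omega> * x)))) ` {-1..1})"
    by (intro bdd_aboveI[of _ "1 + 1"]) auto
qed

section \<open>The Pade approximation as a unitary competitor\<close>

lemma is_pade_exp_reduced:
  assumes "is_pade_exp n r"
  defines "a \<equiv> fst (quot_of_fract r)" and "b \<equiv> snd (quot_of_fract r)"
  shows "degree a \<le> n" and "degree b \<le> n" and "poly b 0 \<noteq> 0"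
proof -
  obtain p q where pq: "degree p \<le> n" "degree q \<le> n" "poly q 0 = 1" "r = Fract p q"
    using assms(1) by (auto simp: is_pade_exp_def)
  then have "q \<noteq> 0"
    by auto
  then obtain g where g: "g \<noteq> 0" "p = a * g" "q = b * g"
    using quot_of_fract_Fract_cancel[of q p] unfolding a_def b_def pq(4) by metis
  have "b \<noteq> 0"
    by (simp add: b_def)
  then have "degree q = degree b + degree g"
    unfolding g(3) using g(1) by (rule degree_mult_eq)
  then show "degree b \<le> n"
    using pq(2) by simp
  show "degree a \<le> n"
  proof (cases "a = 0")
    case False
    then have "degree p = degree a + degree g"
      unfolding g(2) using g(1) by (rule degree_mult_eq)
    then show ?thesis
      using pq(1) by simp
  qed simp
  show "poly b 0 \<noteq> 0"
    using pq(3) by (auto simp: g(3))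
qed

text \<open>
  The defining estimate concerns a punctured neighbourhood of \<open>0\<close>; continuity of the reduced
  quotient extends it to \<open>0\<close> itself.
\<close>

lemma is_pade_exp_error_near_0:
  assumes pade: "is_pade_exp n r"
  obtains C \<delta> where "0 \<le> C" "0 < \<delta>" "\<delta> \<le> 1"
    "\<And>x. \<bar>x\<bar> \<le> \<delta> \<Longrightarrow> poly (snd (quot_of_fract r)) (\<i> * of_real x) \<noteq> 0"
    "\<And>x. \<bar>x\<bar> \<le> \<delta> \<Longrightarrow>
       norm (rat_eval r (\<i> * of_real x) - exp (\<i> * of_real x)) \<le> C * \<bar>x\<bar> ^ (2 * n + 1)"
proof -
  define b where "b = snd (quot_of_fract r)"
  define e where "e z = rat_eval r z - exp z" for z
  have "e \<in> O[at 0](\<lambda>z. z ^ (2 * n + 1))"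
    using pade by (simp add: is_pade_exp_def e_def[abs_def])
  then obtain C where C: "0 < C" "\<forall>\<^sub>F z in at 0. norm (e z) \<le> C * norm (z ^ (2 * n + 1))"
    by (elim landau_o.bigE)
  have b0: "poly b 0 \<noteq> 0"
    unfolding b_def by (rule is_pade_exp_reduced(3)[OF pade])
  then have "isCont e 0"
    unfolding e_def[abs_def] rat_eval_def b_def by (intro continuous_intros) auto
  then have lim: "((\<lambda>z. norm (e z)) \<longlongrightarrow> norm (e 0)) (at 0)"
    by (intro tendsto_norm) (simp add: isCont_def)
  have "((\<lambda>z::complex. C * norm (z ^ (2 * n + 1))) \<longlongrightarrow> C * norm ((0::complex) ^ (2 * n + 1))) (at 0)"
    by (intro tendsto_intros)
  from tendsto_le[OF _ this lim C(2)] have e0: "e 0 = 0"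
    by simp
  have "(poly b \<longlongrightarrow> poly b 0) (at 0)"
    by (intro tendsto_intros)
  then have "\<forall>\<^sub>F z in at 0. poly b z \<noteq> 0"
    using b0 by (rule tendsto_imp_eventually_ne)
  from eventually_conj[OF C(2) this] obtain d where d: "0 < d"
    and near: "\<And>z. z \<noteq> 0 \<Longrightarrow> dist z 0 < d \<Longrightarrow> norm (e z) \<le> C * norm (z ^ (2 * n + 1)) \<and> poly b z \<noteq> 0"
    unfolding eventually_at by blast
  define \<delta> where "\<delta> = min 1 (d / 2)"
  have *: "norm (e (\<i> * of_real x)) \<le> C * \<bar>x\<bar> ^ (2 * n + 1) \<and> poly b (\<i> * of_real x) \<noteq> 0"
    if "\<bar>x\<bar> \<le> \<delta>" for x
  proof (cases "x = 0")
    case True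
    then show ?thesis
      using b0 e0 by simp
  next
    case False
    then show ?thesis
      using near[of "\<i> * of_real x"] that d by (auto simp: \<delta>_def norm_mult norm_power power_mult_distrib)
  qed
  show thesis
    by (rule that[of C \<delta>]) (use C(1) d * in \<open>auto simp: \<delta>_def e_def b_def\<close>)
qed

text \<open>
  On the imaginary axis \<open>F = a * dagger a - b * dagger b\<close> equals \<open>\<bar>b\<bar>\<^sup>2 (\<bar>r\<bar>\<^sup>2 - 1)\<close>, and \<open>\<bar>r\<bar>\<close>
  differs from \<open>\<bar>exp\<bar> = 1\<close> by \<open>O(x^(2n+1))\<close>. Since \<open>F\<close> has degree at most \<open>2n\<close>, its coefficients
  are bounded by a multiple of \<open>h\<close> for every small \<open>h\<close>, so \<open>F = 0\<close>. By coprimality \<open>b\<close> then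
  divides \<open>dagger a\<close>, and for reasons of degree the quotient is a constant \<open>c\<close>. The value \<open>r 0 = 1\<close>
  fixes \<open>c\<close>: after scaling \<open>b\<close> to have value \<open>1\<close> at \<open>0\<close>, no constant is left.
\<close>

lemma is_pade_exp_unitary:
  assumes pade: "is_pade_exp n r"
  defines "a \<equiv> fst (quot_of_fract r)" and "b \<equiv> snd (quot_of_fract r)"
  assumes deg: "degree b = n"
  obtains w \<kappa> where "\<kappa> \<noteq> 0" "a = smult \<kappa> (dagger w)" "b = smult \<kappa> w"
proof -
  obtain C \<delta> where C: "0 \<le> C" and \<delta>: "0 < \<delta>" "\<delta> \<le> 1"
    and nz: "\<And>x. \<bar>x\<bar> \<le> \<delta> \<Longrightarrow> poly b (\<i> * of_real x) \<noteq> 0"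
    and err: "\<And>x. \<bar>x\<bar> \<le> \<delta> \<Longrightarrow>
       norm (rat_eval r (\<i> * of_real x) - exp (\<i> * of_real x)) \<le> C * \<bar>x\<bar> ^ (2 * n + 1)"
    using is_pade_exp_error_near_0[OF pade] unfolding b_def by blast
  define \<kappa> where "\<kappa> = poly b 0"
  have \<kappa>: "\<kappa> \<noteq> 0"
    unfolding \<kappa>_def b_def by (rule is_pade_exp_reduced(3)[OF pade])
  define F where "F = a * dagger a - b * dagger b"
  have dega: "degree a \<le> n"
    unfolding a_def by (rule is_pade_exp_reduced(1)[OF pade])
  have degF: "degree F \<le> 2 * n"
    unfolding F_def using dega deg
    by (intro degree_diff_le order_trans[OF degree_mult_le]) auto
  obtain K where K: "0 \<le> K" "\<And>p B h. degree p \<le> 2 * n \<Longrightarrow> 0 < h \<Longrightarrow> h \<le> 1 \<Longrightarrow>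
     (\<And>x. \<bar>x\<bar> \<le> h \<Longrightarrow> norm (poly p (\<i> * of_real x)) \<le> B * h ^ (2 * n + 1)) \<Longrightarrow>
     coeff_norm p \<le> K * B * h"
    using coeff_norm_bound_of_small_on_imaginary_segment[of "2 * n"] by blast
  define B where "B = (coeff_norm b)\<^sup>2 * (C * (2 + C))"
  have F_small: "norm (poly F (\<i> * of_real x)) \<le> B * h ^ (2 * n + 1)"
    if h: "0 < h" "h \<le> \<delta>" and x: "\<bar>x\<bar> \<le> h" for h x
  proof -
    let ?z = "\<i> * of_real x"
    have "C * \<bar>x\<bar> ^ (2 * n + 1) \<le> C * h ^ (2 * n + 1)"
      using x C by (intro mult_left_mono power_mono) auto
    then have err_h: "norm (rat_eval r ?z - exp ?z) \<le> C * h ^ (2 * n + 1)"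
      using err[of x] x h by linarith
    have "h ^ (2 * n + 1) \<le> 1"
      using h \<delta> by (intro power_le_one) auto
    then have "C * h ^ (2 * n + 1) \<le> C"
      using C by (intro mult_left_le)
    with err_h have err_1: "norm (rat_eval r ?z - exp ?z) \<le> C"
      by linarith
    define \<rho> where "\<rho> = norm (rat_eval r ?z)"
    have dev: "\<bar>\<rho> - 1\<bar> \<le> norm (rat_eval r ?z - exp ?z)"
      using norm_triangle_ineq3[of "rat_eval r ?z" "exp ?z"] by (simp add: \<rho>_def)
    have \<rho>: "0 \<le> \<rho>" "\<rho> \<le> 1 + C"
      using dev err_1 by (auto simp: \<rho>_def)
    have "norm (poly a ?z) = norm (poly b ?z) * \<rho>"
      using nz[of x] x h by (simp add: \<rho>_def rat_eval_def a_def b_def norm_divide)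
    then have "norm (poly F ?z) = \<bar>(norm (poly b ?z) * \<rho>)\<^sup>2 - (norm (poly b ?z))\<^sup>2\<bar>"
      unfolding F_def poly_diff poly_mult poly_dagger_imaginary complex_norm_square[symmetric]
      by (simp only: of_real_diff[symmetric] norm_of_real)
    also have "\<dots> = \<bar>(norm (poly b ?z))\<^sup>2 * ((\<rho> - 1) * (\<rho> + 1))\<bar>"
      by (simp add: power2_eq_square algebra_simps)
    also have "\<dots> = (norm (poly b ?z))\<^sup>2 * (\<bar>\<rho> - 1\<bar> * (\<rho> + 1))"
      using \<rho> by (simp add: abs_mult)
    also have "\<dots> \<le> (coeff_norm b)\<^sup>2 * ((C * h ^ (2 * n + 1)) * (2 + C))"
      using \<rho> dev err_h x h \<delta> C
      by (intro mult_mono power_mono norm_poly_le_coeff_norm) (auto simp: norm_mult)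
    finally show ?thesis
      by (simp add: B_def algebra_simps)
  qed
  have "coeff_norm F \<le> K * B * h" if "0 < h" "h \<le> \<delta>" for h
    using degF that \<delta> F_small by (intro K(2)) auto
  then have "\<forall>\<^sub>F h in at_right 0. coeff_norm F \<le> K * B * h"
    using \<delta> by (auto simp: eventually_at_right_field intro!: exI[of _ \<delta>])
  moreover have "((\<lambda>h. K * B * h) \<longlongrightarrow> K * B * 0) (at_right 0)"
    by (intro tendsto_intros)
  ultimately have "coeff_norm F \<le> K * B * 0"
    by (intro tendsto_lowerbound[of "\<lambda>h. K * B * h" _ "at_right 0"]) auto
  then have "norm (coeff F k) \<le> 0" for k
    using norm_coeff_le_coeff_norm[of F k] by linarith
  then have "F = 0"
    by (simp add: poly_eq_iff)
  then have "b dvd a * dagger a"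
    by (simp add: F_def)
  moreover have "coprime b a"
    unfolding a_def b_def using coprime_quot_of_fract coprime_commute by blast
  ultimately have "b dvd dagger a"
    by (simp add: coprime_dvd_mult_right_iff)
  then obtain g where g: "dagger a = b * g" ..
  have "rat_eval r 0 = 1"
    using err[of 0] \<delta> by simp
  then have a0: "poly a 0 = \<kappa>"
    using \<kappa> by (simp add: rat_eval_def a_def \<kappa>_def b_def)
  have "dagger a \<noteq> 0"
    using a0 \<kappa> poly_dagger[of a 0] by auto
  then have "b \<noteq> 0" "g \<noteq> 0"
    by (auto simp: g)
  then have "degree (dagger a) = n + degree g"
    unfolding g using deg by (simp add: degree_mult_eq)
  then have "degree g = 0"
    using dega by simp
  then obtain c where "g = [:c:]"
    by (rule degree_eq_zeroE)
  with g have dagger_a: "dagger a = smult c b"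
    by simp
  then have c: "cnj \<kappa> = c * \<kappa>"
    using poly_dagger[of a 0] by (simp add: a0 \<kappa>_def)
  define w where "w = smult (1 / \<kappa>) b"
  have "dagger w = smult (1 / cnj \<kappa>) (dagger b)"
    by (simp flip: poly_eq_poly_eq_iff add: fun_eq_iff poly_dagger w_def)
  moreover have "a = smult (cnj c) (dagger b)"
    using arg_cong[OF dagger_a, of dagger]
    by (simp flip: poly_eq_poly_eq_iff add: fun_eq_iff poly_dagger)
  moreover have "cnj c * cnj \<kappa> = \<kappa>"
    using arg_cong[OF c, of cnj] by simp
  then have "cnj c = \<kappa> / cnj \<kappa>"
    using \<kappa> by (simp add: eq_divide_eq)
  ultimately have "a = smult \<kappa> (dagger w)"
    by simp
  moreover have "b = smult \<kappa> w"
    using \<kappa> by (simp add: w_def)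
  ultimately show thesis
    using \<kappa> that by blast
qed

text \<open>
  The competitor is the rescaled Pade approximation \<open>z \<mapsto> rhat (\<omega> z)\<close>.
\<close>

lemma best_approx_error_bound:
  assumes pade: "is_pade_exp n rhat" and deg: "degree (snd (quot_of_fract rhat)) = n"
    and best: "is_unitary_best_approx n \<omega> r"
    and \<omega>: "0 < \<omega>" "\<omega> \<le> \<delta>" and C: "0 \<le> C"
    and nz: "\<And>x. \<bar>x\<bar> \<le> \<delta> \<Longrightarrow> poly (snd (quot_of_fract rhat)) (\<i> * of_real x) \<noteq> 0"
    and err: "\<And>x. \<bar>x\<bar> \<le> \<delta> \<Longrightarrow>
       norm (rat_eval rhat (\<i> * of_real x) - exp (\<i> * of_real x)) \<le> C * \<bar>x\<bar> ^ (2 * n + 1)"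
  shows "approx_error \<omega> r \<le> C * \<omega> ^ (2 * n + 1)"
proof -
  obtain w \<kappa> where w: "\<kappa> \<noteq> 0" "fst (quot_of_fract rhat) = smult \<kappa> (dagger w)"
    "snd (quot_of_fract rhat) = smult \<kappa> w"
    using is_pade_exp_unitary[OF pade deg] by blast
  define p where "p = pcompose w [:0, of_real \<omega>:]"
  define u where "u = Fract (dagger p) p"
  have "degree w = n"
    using deg w by simp
  then have "degree p \<le> n"
    by (simp add: p_def degree_pcompose)
  moreover have "p \<noteq> 0"
    using nz[of 0] \<omega> by (auto simp: p_def w(3) poly_pcompose dest!: arg_cong[where f = "\<lambda>p. poly p 0"])
  ultimately have "u \<in> unitary_ratfuns n"
    by (auto simp: u_def unitary_ratfuns_def)
  with best have "approx_error \<omega> r \<le> approx_error \<omega> u"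
    by (simp add: is_unitary_best_approx_def)
  also have "\<dots> \<le> C * \<omega> ^ (2 * n + 1)"
    unfolding approx_error_def
  proof (rule cSUP_least)
    fix x :: real
    assume x: "x \<in> {-1..1}"
    have small: "\<bar>\<omega> * x\<bar> \<le> \<omega>"
      using x \<omega> by (auto simp: abs_mult intro!: mult_left_le)
    have nz_w: "poly w (\<i> * of_real (\<omega> * x)) \<noteq> 0"
      using nz[of "\<omega> * x"] small \<omega> by (simp add: w(3))
    have "rat_eval u (\<i> * of_real x) = rat_eval rhat (\<i> * of_real (\<omega> * x))"
      unfolding u_def
      by (subst rat_eval_Fract)
         (use nz_w w(1) in \<open>auto simp: p_def dagger_pcompose_of_real poly_pcompose rat_eval_def w(2,3) mult_ac\<close>)
    then have "norm (rat_eval u (\<i> * of_real x) - exp (\<i> * of_real (\<omega> * x)))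
        \<le> C * \<bar>\<omega> * x\<bar> ^ (2 * n + 1)"
      using err[of "\<omega> * x"] small \<omega> by simp
    also have "\<dots> \<le> C * \<omega> ^ (2 * n + 1)"
      using small C by (intro mult_left_mono power_mono) auto
    finally show "norm (rat_eval u (\<i> * of_real x) - exp (\<i> * of_real (\<omega> * x))) \<le> C * \<omega> ^ (2 * n + 1)" .
  qed simp
  finally show ?thesis .
qed

section \<open>Convergence of the rescaled denominators\<close>

text \<open>
  If \<open>P / Q\<close> is as close to \<open>a / b\<close> on \<open>\<i> [-h, h]\<close> as the hypothesis says, then \<open>Q\<close> is close to \<open>b\<close>.
  With \<open>u a + v b = 1\<close> and \<open>D = a Q - P b\<close> one has \<open>Q = u D + (u P + v Q) b\<close>, so \<open>Q\<close> and \<open>u D\<close> have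
  the same remainder modulo \<open>b\<close>. The leading terms of \<open>Q\<close> and \<open>b\<close> cancel, so this remainder is
  \<open>Q - b\<close>, and it is as small as the coefficients of \<open>D\<close>. This
  smallness is relative to \<open>coeff_norm Q\<close>; once \<open>h\<close> is small, it forces \<open>Q\<close> to be at most twice as
  large as \<open>b\<close>, and the estimate becomes absolute.
\<close>

lemma monic_denominators_close:
  fixes a b :: "complex poly"
  assumes "coprime a b" and dega: "degree a \<le> n" and degb: "degree b = n"
    and monic: "lead_coeff b = 1" and n: "n \<ge> 1" and C: "0 \<le> C"
  obtains K h0 where "0 < h0" and
    "\<And>h P Q. 0 < h \<Longrightarrow> h \<le> h0 \<Longrightarrow> degree P \<le> n \<Longrightarrow> degree Q = n \<Longrightarrow> lead_coeff Q = 1 \<Longrightarrow>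
       (\<And>x. \<bar>x\<bar> \<le> h \<Longrightarrow>
          norm (poly (a * Q - P * b) (\<i> * of_real x)) \<le> C * coeff_norm Q * h ^ (2 * n + 1)) \<Longrightarrow>
       coeff_norm (Q - b) \<le> K * h"
proof -
  obtain u v where "u * a + v * b = gcd a b"
    using bezout_coefficients_fst_snd[of a b] by blast
  then have uv: "u * a + v * b = 1"
    using \<open>coprime a b\<close> by simp
  obtain K1 where K1: "0 \<le> K1" "\<And>p B h. degree p \<le> 2 * n \<Longrightarrow> 0 < h \<Longrightarrow> h \<le> 1 \<Longrightarrow>
     (\<And>x. \<bar>x\<bar> \<le> h \<Longrightarrow> norm (poly p (\<i> * of_real x)) \<le> B * h ^ (2 * n + 1)) \<Longrightarrow>
     coeff_norm p \<le> K1 * B * h"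
    using coeff_norm_bound_of_small_on_imaginary_segment[of "2 * n"] by blast
  obtain K2 where K2: "0 \<le> K2"
    "\<And>d. degree d \<le> 2 * n \<Longrightarrow> coeff_norm (u * d mod b) \<le> K2 * coeff_norm d"
    using coeff_norm_mult_mod_bound[of "2 * n" u b] by blast
  define L where "L = K2 * K1 * C"
  have L: "0 \<le> L"
    using K1 K2 C by (simp add: L_def)
  \<comment> \<open>Chosen so that \<open>L * h0 \<le> 1 / 2\<close>, which lets \<open>coeff_norm Q\<close> be absorbed below.\<close>
  define h0 where "h0 = min 1 (1 / (2 * (L + 1)))"
  have h0: "0 < h0" "h0 \<le> 1" "L * h0 \<le> 1 / 2"
  proof -
    have "L * h0 \<le> L * (1 / (2 * (L + 1)))"
      using L by (intro mult_left_mono) (auto simp: h0_def)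
    also have "\<dots> \<le> 1 / 2"
      using L by (simp add: field_simps)
    finally show "L * h0 \<le> 1 / 2" .
  qed (use L in \<open>auto simp: h0_def\<close>)
  have "coeff_norm (Q - b) \<le> (2 * L * coeff_norm b) * h"
    if h: "0 < h" "h \<le> h0" and degP: "degree P \<le> n" and degQ: "degree Q = n" "lead_coeff Q = 1"
      and small: "\<And>x. \<bar>x\<bar> \<le> h \<Longrightarrow>
          norm (poly (a * Q - P * b) (\<i> * of_real x)) \<le> C * coeff_norm Q * h ^ (2 * n + 1)"
    for h P Q
  proof -
    define D where "D = a * Q - P * b"
    have degD: "degree D \<le> 2 * n"
      unfolding D_def using dega degb degP degQ
      by (intro degree_diff_le order_trans[OF degree_mult_le]) auto
    have D: "coeff_norm D \<le> K1 * (C * coeff_norm Q) * h"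
      using degD h h0 small by (intro K1(2)) (auto simp: D_def)
    have "Q = (u * a + v * b) * Q"
      by (simp add: uv)
    also have "\<dots> = u * D + (u * P + v * Q) * b"
      by (simp add: D_def algebra_simps)
    finally have "Q - b = u * D + (u * P + v * Q - 1) * b"
      by (simp add: algebra_simps)
    then have "(Q - b) mod b = u * D mod b"
      by simp
    moreover have "degree (Q - b) < n"
    proof (rule le_neq_implies_less)
      show "degree (Q - b) \<le> n"
        using degQ degb by (intro degree_diff_le) auto
      have "coeff (Q - b) n = 0"
        using degQ degb monic by simp
      then show "degree (Q - b) \<noteq> n"
        using n by (metis degree_0 leading_coeff_0_iff not_one_le_zero)
    qed
    then have "(Q - b) mod b = Q - b"
      by (intro mod_poly_less) (simp add: degb)
    ultimately have "coeff_norm (Q - b) \<le> K2 * coeff_norm D"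
      using K2(2)[OF degD] by simp
    also have "\<dots> \<le> K2 * (K1 * (C * coeff_norm Q) * h)"
      using D K2(1) by (intro mult_left_mono)
    finally have E: "coeff_norm (Q - b) \<le> L * h * coeff_norm Q"
      by (simp add: L_def mult_ac)
    have "L * h \<le> L * h0"
      using h L by (intro mult_left_mono) auto
    then have "L * h * coeff_norm Q \<le> 1 / 2 * coeff_norm Q"
      using h0 by (intro mult_right_mono) auto
    moreover have "coeff_norm Q \<le> coeff_norm (Q - b) + coeff_norm b"
      using coeff_norm_add[of "Q - b" b] by simp
    ultimately have "coeff_norm Q \<le> 2 * coeff_norm b"
      using E by linarith
    then have "L * h * coeff_norm Q \<le> L * h * (2 * coeff_norm b)"
      using L h by (intro mult_left_mono) auto
    with E show ?thesis
      by (simp add: mult_ac)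
  qed
  with h0(1) show thesis
    using that by blast
qed

section \<open>Convergence of the poles\<close>

lemma snd_quot_of_fract_eq_prod:
  assumes "enumerates_poles n s r"
  shows "snd (quot_of_fract r) = (\<Prod>j\<in>{1..n}. [:- s j, 1:])"
proof -
  define b where "b = snd (quot_of_fract r)"
  have "unit_factor b = 1"
    by (simp add: b_def unit_factor_snd_quot_of_fract)
  then have "[:lead_coeff b:] = 1"
    by (simp add: unit_factor_poly_def monom_0)
  then have "lead_coeff b = 1"
    by (simp add: one_pCons)
  then have "b = (\<Prod>x\<in>#proots b. [:- x, 1:])"
    using complex_poly_decompose_multiset[of b] by simp
  also have "proots b = image_mset s (mset_set {1..n})"
    using assms by (simp add: enumerates_poles_def rat_poles_def b_def)
  also have "(\<Prod>x\<in>#\<dots>. [:- x, 1:]) = (\<Prod>j\<in>{1..n}. [:- s j, 1:])"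
    by (simp add: prod_unfold_prod_mset multiset.map_comp o_def)
  finally show ?thesis
    by (simp add: b_def)
qed

lemma degree_prod_linear_factors: "degree (\<Prod>j\<in>{1..n}. [:- s j, 1:]) = n"
  for s :: "nat \<Rightarrow> complex"
  by (simp add: degree_prod_sum_eq)

lemma lead_coeff_prod_linear_factors: "lead_coeff (\<Prod>j\<in>{1..n}. [:- s j, 1:]) = 1"
  for s :: "nat \<Rightarrow> complex"
  by (simp only: lead_coeff_prod) simp

theorem proposition9p2:
  fixes n :: nat
    and rhat :: ratfun and shat :: "nat \<Rightarrow> complex"
    and r :: "real \<Rightarrow> ratfun" and s :: "real \<Rightarrow> nat \<Rightarrow> complex"
  assumes "n \<ge> 1"
    and "is_pade_exp n rhat"
    and "enumerates_poles n shat rhat"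
    and "\<And>\<omega>. 0 < \<omega> \<Longrightarrow> \<omega> < (real n + 1) * pi \<Longrightarrow> is_unitary_best_approx n \<omega> (r \<omega>)"
    and "\<And>\<omega>. 0 < \<omega> \<Longrightarrow> \<omega> < (real n + 1) * pi \<Longrightarrow> enumerates_poles n (s \<omega>) (r \<omega>)"
  shows "\<exists>\<sigma> :: real \<Rightarrow> nat \<Rightarrow> nat.
           (\<forall>\<omega>. \<sigma> \<omega> permutes {1..n}) \<and>
           (\<forall>j\<in>{1..n}. ((\<lambda>\<omega>. of_real \<omega> * s \<omega> (\<sigma> \<omega> j)) \<longlongrightarrow> shat j) (at_right 0))"
proof (rule roots_tendsto_up_to_numbering)
  define a where "a = fst (quot_of_fract rhat)"
  define b where "b = (\<Prod>j\<in>{1..n}. [:- shat j, 1:])"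
  define Q where "Q \<omega> = (\<Prod>j\<in>{1..n}. [:- (of_real \<omega> * s \<omega> j), 1:])" for \<omega> :: real
  have b: "snd (quot_of_fract rhat) = b"
    unfolding b_def using assms(3) by (rule snd_quot_of_fract_eq_prod)
  have degb: "degree b = n" and degQ: "degree (Q \<omega>) = n"
    and monic: "lead_coeff b = 1" "lead_coeff (Q \<omega>) = 1" for \<omega>
    unfolding b_def Q_def by (rule degree_prod_linear_factors lead_coeff_prod_linear_factors)+
  obtain C \<delta> where C: "0 \<le> C" and \<delta>: "0 < \<delta>" "\<delta> \<le> 1"
    and nz: "\<And>x. \<bar>x\<bar> \<le> \<delta> \<Longrightarrow> poly b (\<i> * of_real x) \<noteq> 0"
    and err: "\<And>x. \<bar>x\<bar> \<le> \<delta> \<Longrightarrow>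
       norm (rat_eval rhat (\<i> * of_real x) - exp (\<i> * of_real x)) \<le> C * \<bar>x\<bar> ^ (2 * n + 1)"
    using is_pade_exp_error_near_0[OF assms(2)] unfolding b by blast
  have cop: "coprime a b"
    unfolding a_def b[symmetric] by (rule coprime_quot_of_fract)
  have dega: "degree a \<le> n"
    unfolding a_def by (rule is_pade_exp_reduced(1)[OF assms(2)])
  have nonneg: "0 \<le> 2 * C * coeff_norm b"
    using C by simp
  obtain K h0 where h0: "0 < h0" and close:
    "\<And>h P Q. 0 < h \<Longrightarrow> h \<le> h0 \<Longrightarrow> degree P \<le> n \<Longrightarrow> degree Q = n \<Longrightarrow> lead_coeff Q = 1 \<Longrightarrow>
       (\<And>x. \<bar>x\<bar> \<le> h \<Longrightarrow> norm (poly (a * Q - P * b) (\<i> * of_real x))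
          \<le> 2 * C * coeff_norm b * coeff_norm Q * h ^ (2 * n + 1)) \<Longrightarrow>
       coeff_norm (Q - b) \<le> K * h"
    using monic_denominators_close[OF cop dega degb monic(1) assms(1) nonneg] by metis
  have bound: "coeff_norm (Q \<omega> - b) \<le> K * \<omega>" if \<omega>: "0 < \<omega>" "\<omega> \<le> \<delta>" "\<omega> \<le> h0" for \<omega>
  proof -
    have "1 * 1 < (real n + 1) * pi"
      using pi_gt3 by (intro mult_le_less_imp_less) auto
    then have "\<omega> < (real n + 1) * pi"
      using \<omega> \<delta> by simp
    then have best: "is_unitary_best_approx n \<omega> (r \<omega>)" and poles: "enumerates_poles n (s \<omega>) (r \<omega>)"
      using assms(4,5) \<omega> by auto
    have unitary: "r \<omega> \<in> unitary_ratfuns n"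
      using best by (simp add: is_unitary_best_approx_def)
    define p q where "p = fst (quot_of_fract (r \<omega>))" and "q = snd (quot_of_fract (r \<omega>))"
    \<comment> \<open>The factor \<open>\<omega> ^ n\<close> matches the one by which \<open>q (z / \<omega>)\<close> must be multiplied to become monic.\<close>
    define P where "P = smult (of_real \<omega> ^ n) (pcompose p [:0, of_real (1 / \<omega>):])"
    have q: "q = (\<Prod>j\<in>{1..n}. [:- s \<omega> j, 1:])"
      unfolding q_def using poles by (rule snd_quot_of_fract_eq_prod)
    show ?thesis
    proof (rule close[of \<omega> P "Q \<omega>"])
      have "degree p \<le> n"
        unfolding p_def by (rule unitary_ratfun_reduced(1)[OF unitary])
      then show "degree P \<le> n"
        using \<omega> by (simp add: P_def degree_pcompose)
      fix x :: real
      assume x: "\<bar>x\<bar> \<le> \<omega>"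
      define y where "y = x / \<omega>"
      have y: "\<bar>y\<bar> \<le> 1" "x = \<omega> * y"
        using x \<omega> by (auto simp: y_def)
      let ?z = "\<i> * of_real x"
      have Pz: "poly P ?z = of_real \<omega> ^ n * poly p (\<i> * of_real y)"
        using \<omega> by (simp add: P_def poly_pcompose y(2))
      have Qz: "poly (Q \<omega>) ?z = of_real \<omega> ^ n * poly q (\<i> * of_real y)"
      proof -
        have "poly (Q \<omega>) ?z = (\<Prod>j\<in>{1..n}. of_real \<omega> * (\<i> * of_real y - s \<omega> j))"
          by (simp add: Q_def poly_prod y(2) algebra_simps)
        then show ?thesis
          by (simp add: q poly_prod prod.distrib)
      qed
      have qy: "poly q (\<i> * of_real y) \<noteq> 0"
        unfolding q_def by (rule unitary_ratfun_reduced(3)[OF unitary])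
      have "poly (a * Q \<omega> - P * b) ?z = poly (Q \<omega>) ?z * poly b ?z *
          (rat_eval rhat ?z - rat_eval (r \<omega>) (\<i> * of_real y))"
        using qy nz[of x] x \<omega> unfolding rat_eval_def b a_def[symmetric] p_def[symmetric] q_def[symmetric]
        by (simp add: Pz Qz field_simps)
      then have "norm (poly (a * Q \<omega> - P * b) ?z) = norm (poly (Q \<omega>) ?z) * norm (poly b ?z) *
          norm (rat_eval rhat ?z - rat_eval (r \<omega>) (\<i> * of_real y))"
        by (simp only: norm_mult)
      also have "\<dots> \<le> coeff_norm (Q \<omega>) * coeff_norm b * (2 * C * \<omega> ^ (2 * n + 1))"
      proof (intro mult_mono norm_poly_le_coeff_norm)
        have "norm (rat_eval rhat ?z - exp ?z) \<le> C * \<bar>x\<bar> ^ (2 * n + 1)"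
          using x \<omega> by (intro err) auto
        also have "\<dots> \<le> C * \<omega> ^ (2 * n + 1)"
          using x C by (intro mult_left_mono power_mono) auto
        finally have "norm (rat_eval rhat ?z - exp ?z) \<le> C * \<omega> ^ (2 * n + 1)" .
        moreover have "norm (rat_eval (r \<omega>) (\<i> * of_real y) - exp ?z) \<le> C * \<omega> ^ (2 * n + 1)"
          using norm_diff_exp_le_approx_error[OF unitary y(1), of \<omega>]
            best_approx_error_bound[OF assms(2) _ best \<omega>(1,2) C, unfolded b, OF degb nz err] y(2)
          by simp
        moreover have "norm (rat_eval rhat ?z - rat_eval (r \<omega>) (\<i> * of_real y))
            \<le> norm (rat_eval rhat ?z - exp ?z) + norm (rat_eval (r \<omega>) (\<i> * of_real y) - exp ?z)"
          using norm_triangle_ineq4[of "rat_eval rhat ?z - exp ?z" "rat_eval (r \<omega>) (\<i> * of_real y) - exp ?z"]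
          by simp
        ultimately show "norm (rat_eval rhat ?z - rat_eval (r \<omega>) (\<i> * of_real y))
            \<le> 2 * C * \<omega> ^ (2 * n + 1)"
          by linarith
      qed (use x \<omega> \<delta> in \<open>auto simp: norm_mult\<close>)
      finally show "norm (poly (a * Q \<omega> - P * b) ?z)
          \<le> 2 * C * coeff_norm b * coeff_norm (Q \<omega>) * \<omega> ^ (2 * n + 1)"
        by (simp add: mult_ac)
    qed (use \<omega> degQ monic in auto)
  qed
  fix k
  have le: "\<forall>\<^sub>F \<omega> in at_right 0. norm (coeff (Q \<omega>) k - coeff b k) \<le> K * \<omega>"
  proof -
    have "norm (coeff (Q \<omega>) k - coeff b k) \<le> K * \<omega>" if "0 < \<omega>" "\<omega> < min \<delta> h0" for \<omega>
      using norm_coeff_le_coeff_norm[of "Q \<omega> - b" k] bound[of \<omega>] that by simp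
    then show ?thesis
      using \<delta> h0 by (auto simp: eventually_at_right_field intro!: exI[of _ "min \<delta> h0"])
  qed
  have "((\<lambda>\<omega>. K * \<omega>) \<longlongrightarrow> K * 0) (at_right 0)"
    by (intro tendsto_intros)
  then have lim: "((\<lambda>\<omega>. K * \<omega>) \<longlongrightarrow> 0) (at_right 0)"
    by simp
  show "((\<lambda>\<omega>. coeff (\<Prod>j\<in>{1..n}. [:- (of_real \<omega> * s \<omega> j), 1:]) k)
      \<longlongrightarrow> coeff (\<Prod>j\<in>{1..n}. [:- shat j, 1:]) k) (at_right 0)"
    using Lim_null_comparison[OF le lim] unfolding Q_def b_def by (rule LIM_zero_cancel)
qed

end
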